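(* Let $\mathcal{X},\mathcal{Y}$ be finite-dimensional Banach spaces, let $\mathbf{A}:\mathcal{X}\to\mathcal{Y}$ be linear, and let $\tilde{\kappa}=\tilde{\kappa}_{\mathcal{X}\to\mathcal{Y}}(\mathbf{A})$ be its non-linear condition number. For $i\in\{1,2\}$ let $F_i$ be an $(\alpha_i,\beta_i/\tilde{\kappa})$-algorithm for $\mathbf{A}$. Then the composition $F_2\circ F_1$ is an $(\alpha_1+\alpha_2\beta_1,\ \beta_1\beta_2/\tilde{\kappa})$-algorithm for $\mathbf{A}$.
   Context: For $\mathbf{b}$ in the image of $\mathbf{A}$, let $\mathbf{x}_{\mathsf{opt}}$ denote any $x\in\mathcal{X}$ with $\mathbf{A}x=\mathbf{b}$ and $\|x\|_{\mathcal{X}}$ minimal. A point $x\in\mathcal{X}$ is an $(\alpha,\beta)$-solution for $\mathbf{b}$ if $\|x\|_{\mathcal{X}}\le \alpha\|\mathbf{x}_{\mathsf{opt}}\|_{\mathcal{X}}$ and $\|\mathbf{A}x-\mathbf{b}\|_{\mathcal{Y}}\le \beta\,\|\mathbf{A}\|_{\mathcal{X}\to\mathcal{Y}}\|\mathbf{x}_{\mathsf{opt}}\|_{\mathcal{X}}$. An $(\alpha,\beta)$-algorithm (or solver) for $\mathbf{A}$ is an algorithm which, on every input $\mathbf{b}$ in the image of $\mathbf{A}$, outputs an $(\alpha,\beta)$-solution for $\mathbf{b}$. The non-linear condition number is $\tilde{\kappa}_{\mathcal{X}\to\mathcal{Y}}(\mathbf{A})=\sup\{\|\mathbf{A}\|_{\mathcal{X}\to\mathcal{Y}}\cdot\min\{\|x\|_{\mathcal{X}}:\mathbf{A}x=\mathbf{b}\}/\|\mathbf{b}\|_{\mathcal{Y}}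 : \mathbf{b}\in\operatorname{im}\mathbf{A},\ \mathbf{b}\neq 0\}$. The composition $F_2\circ F_1$ takes input $\mathbf{b}$, runs $F_1$ on $\mathbf{b}$ to get $x$, sets $\tilde{\mathbf{b}}=\mathbf{b}-\mathbf{A}x$, runs $F_2$ on $\tilde{\mathbf{b}}$ to get $\tilde{x}$, and outputs $x+\tilde{x}$. *)

theory Defs
  imports "HOL-Analysis.Analysis"
begin

text \<open>
  If a minimizer exists, as it always does for linear \<open>A\<close> on a finite-dimensional space and
  \<open>b \<in> range A\<close>, this is some minimizer; all notions below depend only on its norm,
  which is the same for all minimizers.
\<close>

definition x_opt :: "('x::real_normed_vector \<Rightarrow> 'y::real_normed_vector) \<Rightarrow> 'y \<Rightarrow> 'x"
  where "x_opt A b = (ARG_MIN norm x. A x = b)"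

definition is_solution ::
    "('x::real_normed_vector \<Rightarrow> 'y::real_normed_vector) \<Rightarrow> real \<Rightarrow> real \<Rightarrow> 'y \<Rightarrow> 'x \<Rightarrow> bool"
  where "is_solution A \<alpha> \<beta> b x \<longleftrightarrow>
    norm x \<le> \<alpha> * norm (x_opt A b) \<and>
    norm (A x - b) \<le> \<beta> * onorm A * norm (x_opt A b)"

text \<open>An algorithm is represented by its input-output function; nothing is required of it
  on inputs outside the image of \<open>A\<close>.\<close>

definition is_algorithm ::
    "('x::real_normed_vector \<Rightarrow> 'y::real_normed_vector) \<Rightarrow> real \<Rightarrow> real \<Rightarrow> ('y \<Rightarrow> 'x) \<Rightarrow> bool"
  where "is_algorithm A \<alpha> \<beta> F \<longleftrightarrow> (\<forall>b \<in> range A. is_solution A \<alpha> \<beta> b (F b))"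

text \<open>
  The term \<open>norm (x_opt A b)\<close> is the minimum of \<open>norm x\<close> over \<open>A x = b\<close>.  For linear \<open>A\<close>
  between finite-dimensional spaces the set is bounded above.  It is empty only
  for \<open>A = 0\<close>, where the value of the supremum is immaterial: then \<open>b = 0\<close> is the only
  input, \<open>x_opt A b = 0\<close>, and \<open>is_solution\<close> does not depend on \<open>\<beta>\<close>.
\<close>

definition nl_cond :: "('x::real_normed_vector \<Rightarrow> 'y::real_normed_vector) \<Rightarrow> real"
  where "nl_cond A = Sup {onorm A * norm (x_opt A b) / norm b | b. b \<in> range A \<and> b \<noteq> 0}"

definition alg_comp ::
    "('x::real_normed_vector \<Rightarrow> 'y::real_normed_vector) \<Rightarrow> ('y \<Rightarrow> 'x) \<Rightarrow> ('y \<Rightarrow> 'x) \<Rightarrow> 'y \<Rightarrow> 'x"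
  where "alg_comp A F2 F1 b =
    (let x = F1 b; b' = b - A x; x' = F2 b' in x + x')"

end

theory Submission
  imports Defs
begin

text \<open>
  Write \<open>m b\<close> for the minimal norm of a preimage of \<open>b\<close>.  The residual \<open>b' = b - A (F1 b)\<close> lies in
  the image of \<open>A\<close>, and the definition of the condition number \<open>\<kappa>\<close> gives
  \<open>\<parallel>A\<parallel> m b' \<le> \<kappa> \<parallel>b'\<parallel> \<le> \<beta>1 \<parallel>A\<parallel> m b\<close>, so \<open>m b' \<le> \<beta>1 m b\<close>; the two guarantees for \<open>F2\<close> on input
  \<open>b'\<close> then yield the claim.  Finite dimension ensures that \<open>m b\<close> is attained and that
  \<open>\<kappa>\<close> is the supremum of a bounded set, since a linear right inverse of \<open>A\<close> on its image is bounded.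
\<close>

section \<open>Coordinates, boundedness and compactness in finite-dimensional normed spaces\<close>

text \<open>This is the image of the maximum-norm unit ball under the map from coefficients to
  vectors. It provides a compact set before balls are known to be compact.\<close>

definition coord_cube :: "'a::real_normed_vector set \<Rightarrow> 'a set"
  where "coord_cube B = {\<Sum>b\<in>B. a b *\<^sub>R b | a. \<forall>b\<in>B. \<bar>a b\<bar> \<le> 1}"

text \<open>Adding a vector \<open>b\<close> to \<open>B\<close> turns the cube into the Minkowski
  sum of a compact segment along \<open>b\<close> and the cube of \<open>B\<close>.\<close>

lemma compact_coord_cube:
  assumes "finite B"
  shows "compact (coord_cube B)"
  using assms
proof induction
  case empty
  then show ?case by (simp add: coord_cube_def)
next
  case (insert b B)
  have "coord_cube (insert b B) = {x + y | x y. x \<in> (\<lambda>t. t *\<^sub>R b) ` {-1..1} \<and> y \<in> coord_cube B}"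
    (is "?L = ?R")
  proof (intro subset_antisym subsetI)
    fix x assume "x \<in> ?L"
    then show "x \<in> ?R"
      using insert.hyps by (fastforce simp: coord_cube_def abs_le_iff)
  next
    fix x assume "x \<in> ?R"
    then obtain t a where t: "\<bar>t\<bar> \<le> 1" and a: "\<forall>c\<in>B. \<bar>a c\<bar> \<le> 1"
      and x: "x = t *\<^sub>R b + (\<Sum>c\<in>B. a c *\<^sub>R c)"
      by (auto simp: coord_cube_def abs_le_iff)
    have "(\<Sum>c\<in>B. (a(b := t)) c *\<^sub>R c) = (\<Sum>c\<in>B. a c *\<^sub>R c)"
      using insert.hyps by (intro sum.cong) auto
    then have "x = (\<Sum>c\<in>insert b B. (a(b := t)) c *\<^sub>R c)"
      using x insert.hyps by simp
    moreover have "\<forall>c\<in>insert b B. \<bar>(a(b := t)) c\<bar> \<le> 1"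
      using t a by simp
    ultimately show "x \<in> ?L"
      unfolding coord_cube_def by blast
  qed
  moreover have "compact ((\<lambda>t. t *\<^sub>R b) ` {-1..1::real})"
    by (intro compact_continuous_image continuous_intros) auto
  ultimately show ?case
    using insert.IH by (simp add: compact_sums)
qed

text \<open>The compact set \<open>S\<close> in the proof consists, up to sign, of the vectors whose coordinate vector
  has maximum norm 1.\<close>

lemma independent_coord_bound:
  fixes B :: "'a::real_normed_vector set"
  assumes "finite B" and "independent B"
  obtains \<delta> where "\<delta> > 0" and "\<And>a b. b \<in> B \<Longrightarrow> \<delta> * \<bar>a b\<bar> \<le> norm (\<Sum>c\<in>B. a c *\<^sub>R c)"
proof -
  define S where "S = (\<Union>b\<in>B. (+) b ` coord_cube (B - {b}))"
  have "compact S"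
    unfolding S_def using assms(1)
    by (intro compact_UN compact_translation compact_coord_cube) auto
  moreover have "0 \<notin> S"
  proof
    assume "0 \<in> S"
    then obtain b a where b: "b \<in> B" and "b + (\<Sum>c\<in>B - {b}. a c *\<^sub>R c) = 0"
      by (auto simp: S_def coord_cube_def)
    then have "b = - (\<Sum>c\<in>B - {b}. a c *\<^sub>R c)"
      by (simp add: eq_neg_iff_add_eq_0)
    also have "\<dots> \<in> span (B - {b})"
      by (intro span_neg span_sum span_scale span_base)
    finally have "b \<in> span (B - {b})" .
    then show False
      using assms(2) b dependent_def by blast
  qed
  ultimately have "open (- S)" "0 \<in> - S"
    using compact_imp_closed by auto
  then obtain \<delta> where \<delta>: "\<delta> > 0" "ball 0 \<delta> \<subseteq> - S"
    using open_contains_ball by metis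
  then have S_bound: "\<delta> \<le> norm x" if "x \<in> S" for x
    using that by (meson ComplD linorder_not_le mem_ball_0 subsetD)
  show thesis
  proof (rule that[OF \<delta>(1)])
    fix a :: "'a \<Rightarrow> real" and b assume b: "b \<in> B"
    define M where "M = Max ((\<lambda>c. \<bar>a c\<bar>) ` B)"
    have M: "\<bar>a c\<bar> \<le> M" if "c \<in> B" for c
      using assms(1) that by (simp add: M_def)
    obtain m where m: "m \<in> B" "\<bar>a m\<bar> = M"
      using Max_in[of "(\<lambda>c. \<bar>a c\<bar>) ` B"] assms(1) b unfolding M_def by fastforce
    have "\<delta> * M \<le> norm (\<Sum>c\<in>B. a c *\<^sub>R c)"
    proof (cases "M = 0")
      case False
      then have am: "a m \<noteq> 0" using m by auto
      \<comment> \<open>Dividing by the signed coefficient of largest modulus makes the coefficient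
        of \<open>m\<close> exactly 1 and all others at most 1 in modulus, which puts
        \<open>?v\<close> into \<open>S\<close>.\<close>
      let ?v = "m + (\<Sum>c\<in>B - {m}. (a c / a m) *\<^sub>R c)"
      have "\<forall>c\<in>B - {m}. \<bar>a c / a m\<bar> \<le> 1"
        using M m am by (auto simp: divide_le_eq)
      then have "(\<Sum>c\<in>B - {m}. (a c / a m) *\<^sub>R c) \<in> coord_cube (B - {m})"
        unfolding coord_cube_def by (intro CollectI exI[of _ "\<lambda>c. a c / a m"]) auto
      then have "\<delta> \<le> norm ?v"
        using m(1) by (intro S_bound) (auto simp: S_def)
      moreover have "(\<Sum>c\<in>B. a c *\<^sub>R c) = a m *\<^sub>R ?v"
        using assms(1) m(1) am
        by (simp add: sum.remove[of B m] scaleR_add_right scaleR_sum_right)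
      ultimately show ?thesis
        using m(2) by (simp add: mult.commute mult_left_mono)
    qed simp
    then show "\<delta> * \<bar>a b\<bar> \<le> norm (\<Sum>c\<in>B. a c *\<^sub>R c)"
      using M[OF b] \<delta>(1) by (meson dual_order.trans less_imp_le mult_left_mono)
  qed
qed

text \<open>A basis is extracted from the spanning set so that
  \<open>independent_coord_bound\<close> applies. Boundedness of linear maps and compactness of
  balls are both derived from these coordinates.\<close>

lemma finite_dim_coordinates:
  assumes "\<exists>B :: 'a set. finite B \<and> span B = UNIV"
  obtains B :: "'a::real_normed_vector set" and a and \<delta> :: real where "finite B" and "\<delta> > 0"
    and "\<And>x. x = (\<Sum>b\<in>B. a x b *\<^sub>R b)" and "\<And>x b. b \<in> B \<Longrightarrow> \<bar>a x b\<bar> \<le> norm x / \<delta>"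
proof -
  obtain B0 :: "'a set" where B0: "finite B0" "span B0 = UNIV" using assms by blast
  obtain B where B: "B \<subseteq> B0" "independent B" "span B = UNIV"
  proof (rule maximal_independent_subset[of B0])
    fix B assume B: "B \<subseteq> B0" "independent B" "B0 \<subseteq> span B"
    have "span B = UNIV"
      using span_minimal[OF B(3) subspace_span] B0(2) by blast
    with B(1,2) show thesis by (rule that)
  qed
  have fin: "finite B" using B(1) B0(1) finite_subset by blast
  obtain \<delta> where \<delta>: "\<delta> > 0" "\<And>a b. b \<in> B \<Longrightarrow> \<delta> * \<bar>a b\<bar> \<le> norm (\<Sum>c\<in>B. a c *\<^sub>R c)"
    using independent_coord_bound[OF fin B(2)] by metis
  have "\<exists>a. x = (\<Sum>b\<in>B. a b *\<^sub>R b)" for x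
    using B(3) span_finite[OF fin] by blast
  then obtain a where a: "\<And>x. x = (\<Sum>b\<in>B. a x b *\<^sub>R b)" by metis
  show thesis
  proof (rule that[OF fin \<delta>(1) a])
    fix x b assume "b \<in> B"
    from \<delta>(2)[OF this, of "a x"] show "\<bar>a x b\<bar> \<le> norm x / \<delta>"
      unfolding a[of x, symmetric] using \<delta>(1) by (simp add: pos_le_divide_eq mult.commute)
  qed
qed

text \<open>Each coordinate is bounded by a multiple of the norm, and \<open>f\<close> is determined
  by its values on \<open>B\<close>. This makes \<open>onorm\<close> a genuine bound, both for
  \<open>A\<close> and for its right inverse.\<close>

lemma finite_dim_linear_bounded:
  fixes f :: "'a::real_normed_vector \<Rightarrow> 'b::real_normed_vector"
  assumes "\<exists>B :: 'a set. finite B \<and> span B = UNIV" and "linear f"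
  shows "bounded_linear f"
proof -
  obtain B :: "'a set" and a and \<delta> :: real where fin: "finite B" and "\<delta> > 0"
    and a: "\<And>x. x = (\<Sum>b\<in>B. a x b *\<^sub>R b)" and le: "\<And>x b. b \<in> B \<Longrightarrow> \<bar>a x b\<bar> \<le> norm x / \<delta>"
    by (rule finite_dim_coordinates[OF assms(1)]) (rule that)
  show ?thesis
  proof (rule bounded_linear_intro[where K = "\<Sum>b\<in>B. norm (f b) / \<delta>"])
    fix x
    have "f x = (\<Sum>b\<in>B. a x b *\<^sub>R f b)"
      using arg_cong[OF a[of x], of f] by (simp add: linear_sum[OF assms(2)] linear_scale[OF assms(2)])
    also have "norm \<dots> \<le> (\<Sum>b\<in>B. \<bar>a x b\<bar> * norm (f b))"
      by (rule sum_norm_le) simp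
    also have "\<dots> \<le> (\<Sum>b\<in>B. norm x / \<delta> * norm (f b))"
      by (intro sum_mono mult_right_mono le) auto
    finally show "norm (f x) \<le> norm x * (\<Sum>b\<in>B. norm (f b) / \<delta>)"
      by (simp add: sum_distrib_left)
  qed (simp_all add: linear_add[OF assms(2)] linear_scale[OF assms(2)])
qed

text \<open>The coordinate bound places the ball inside a scaled copy of the compact cube, where it
  is a closed subset.\<close>

lemma finite_dim_compact_cball:
  fixes r :: real
  assumes "\<exists>B :: 'a set. finite B \<and> span B = UNIV"
  shows "compact (cball (0::'a::real_normed_vector) r)"
proof -
  obtain B :: "'a set" and a and \<delta> :: real where fin: "finite B" and "\<delta> > 0"
    and a: "\<And>x. x = (\<Sum>b\<in>B. a x b *\<^sub>R b)" and le: "\<And>x b. b \<in> B \<Longrightarrow> \<bar>a x b\<bar> \<le> norm x / \<delta>"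
    by (rule finite_dim_coordinates[OF assms]) (rule that)
  \<comment> \<open>The absolute value and the \<open>+ 1\<close> keep \<open>R\<close> positive for
    negative and zero \<open>r\<close>, so that coordinates can be divided by it.\<close>
  define R where "R = (\<bar>r\<bar> + 1) / \<delta>"
  have R: "R > 0" using \<open>\<delta> > 0\<close> by (simp add: R_def)
  have "cball 0 r \<subseteq> (*\<^sub>R) R ` coord_cube B"
  proof
    fix x :: 'a assume x: "x \<in> cball 0 r"
    have "\<bar>a x b / R\<bar> \<le> 1" if "b \<in> B" for b
    proof -
      have "norm x / \<delta> \<le> R"
        unfolding R_def using x \<open>\<delta> > 0\<close> by (intro divide_right_mono) auto
      then have "\<bar>a x b\<bar> \<le> R" using le[OF that, of x] by linarith
      then show ?thesis using R by (simp add: divide_le_eq)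
    qed
    then have cube: "(\<Sum>b\<in>B. (a x b / R) *\<^sub>R b) \<in> coord_cube B"
      unfolding coord_cube_def by (intro CollectI exI[of _ "\<lambda>b. a x b / R"]) auto
    have "R *\<^sub>R (\<Sum>b\<in>B. (a x b / R) *\<^sub>R b) = (\<Sum>b\<in>B. a x b *\<^sub>R b)"
      using R by (simp add: scaleR_sum_right)
    then have "x = R *\<^sub>R (\<Sum>b\<in>B. (a x b / R) *\<^sub>R b)"
      by (simp only: a[of x, symmetric])
    then show "x \<in> (*\<^sub>R) R ` coord_cube B"
      using cube by (rule image_eqI)
  qed
  moreover have "compact ((*\<^sub>R) R ` coord_cube B)"
    by (rule compact_scaling) (rule compact_coord_cube[OF fin])
  ultimately show ?thesis
    using compact_Int_closed[of "(*\<^sub>R) R ` coord_cube B" "cball 0 r"] by (simp add: inf.absorb2)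
qed

section \<open>Minimal-norm preimages and the condition number\<close>

text \<open>\<open>ARG_MIN\<close> is a choice operator and is informative only once a minimizer
  exists. One exists because the preimages in the ball of radius \<open>norm x\<close> form a
  nonempty compact set.\<close>

lemma x_opt_minimizer:
  fixes A :: "'x::real_normed_vector \<Rightarrow> 'y::real_normed_vector"
  assumes fin: "\<exists>B :: 'x set. finite B \<and> span B = UNIV"
    and lin: "linear A" and x: "A x = b"
  shows "A (x_opt A b) = b" and "norm (x_opt A b) \<le> norm x"
proof -
  have "continuous_on UNIV A"
    using finite_dim_linear_bounded[OF fin lin] by (simp add: linear_continuous_on)
  then have "closed {z. A z = b}"
    by (intro closed_Collect_eq continuous_on_const)
  then have "compact (cball 0 (norm x) \<inter> {z. A z = b})"
    by (intro compact_Int_closed finite_dim_compact_cball[OF fin])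
  moreover have "cball 0 (norm x) \<inter> {z. A z = b} \<noteq> {}" using x by auto
  ultimately have "\<exists>z\<in>cball 0 (norm x) \<inter> {z. A z = b}.
      \<forall>y\<in>cball 0 (norm x) \<inter> {z. A z = b}. norm z \<le> norm y"
    by (rule continuous_attains_inf[OF _ _ continuous_on_norm_id])
  then obtain z where z: "z \<in> cball 0 (norm x) \<inter> {z. A z = b}"
    "\<And>y. y \<in> cball 0 (norm x) \<inter> {z. A z = b} \<Longrightarrow> norm z \<le> norm y"
    by blast
  from z(1) have Az: "A z = b" by simp
  \<comment> \<open>Minimality extends from the ball to all preimages: outside it the norm exceeds
    \<open>norm x\<close>, which is at least \<open>norm z\<close>.\<close>
  have z_min: "\<not> norm y < norm z" if "A y = b" for y
  proof (cases "norm y \<le> norm x")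
    case True
    then show ?thesis using z(2)[of y] that by simp
  next
    case False
    then show ?thesis using z(1) by simp
  qed
  have "A (x_opt A b) = b \<and> (\<forall>y. A y = b \<longrightarrow> norm (x_opt A b) \<le> norm y)"
    unfolding x_opt_def by (rule arg_minI[of "\<lambda>x. A x = b" z norm, OF Az z_min]) (simp_all add: not_less)
  then show "A (x_opt A b) = b" and "norm (x_opt A b) \<le> norm x" using x by blast+
qed

text \<open>The right inverse \<open>g\<close> is linear on all of the target space, hence bounded,
  and \<open>g b\<close> is a competitor for the minimum.\<close>

lemma norm_x_opt_bounded:
  fixes A :: "'x::real_normed_vector \<Rightarrow> 'y::real_normed_vector"
  assumes finx: "\<exists>B :: 'x set. finite B \<and> span B = UNIV"
    and finy: "\<exists>B :: 'y set. finite B \<and> span B = UNIV"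
    and lin: "linear A"
  obtains K where "\<And>b. b \<in> range A \<Longrightarrow> norm (x_opt A b) \<le> K * norm b"
proof -
  obtain g where g: "linear g" "\<And>b. b \<in> range A \<Longrightarrow> A (g b) = b"
    using linear_exists_right_inverse_on[OF lin subspace_UNIV] by auto
  have "norm (x_opt A b) \<le> onorm g * norm b" if "b \<in> range A" for b
    using x_opt_minimizer(2)[OF finx lin g(2)[OF that]]
      onorm[OF finite_dim_linear_bounded[OF finy g(1)], of b] by linarith
  then show thesis by (rule that)
qed

text \<open>A real \<open>Sup\<close> is known to dominate its elements only if the set is bounded
  above; \<open>onorm A * K\<close> is such a bound.\<close>

lemma onorm_x_opt_le_nl_cond:
  fixes A :: "'x::real_normed_vector \<Rightarrow> 'y::real_normed_vector"
  assumes "\<exists>B :: 'x set. finite B \<and> span B = UNIV"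
    and "\<exists>B :: 'y set. finite B \<and> span B = UNIV"
    and "linear A" and "b \<in> range A" and "b \<noteq> 0"
  shows "onorm A * norm (x_opt A b) \<le> nl_cond A * norm b"
proof -
  let ?S = "{onorm A * norm (x_opt A b) / norm b | b. b \<in> range A \<and> b \<noteq> 0}"
  obtain K where K: "\<And>b. b \<in> range A \<Longrightarrow> norm (x_opt A b) \<le> K * norm b"
    using norm_x_opt_bounded[OF assms(1-3)] by metis
  have "0 \<le> onorm A"
    using onorm_pos_le finite_dim_linear_bounded assms(1,3) by blast
  then have "bdd_above ?S"
    using K by (intro bdd_aboveI[of _ "onorm A * K"])
      (auto simp: divide_le_eq mult.assoc intro!: mult_left_mono)
  then have "onorm A * norm (x_opt A b) / norm b \<le> nl_cond A"
    unfolding nl_cond_def using assms(4,5) by (intro cSup_upper) auto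
  then show ?thesis using assms(5) by (simp add: divide_le_eq)
qed

section \<open>Composition of two solvers\<close>

theorem mainTheorem1:
  fixes A :: "'x::banach \<Rightarrow> 'y::banach"
    and F1 F2 :: "'y \<Rightarrow> 'x"
    and \<alpha>1 \<alpha>2 \<beta>1 \<beta>2 :: real
  assumes "\<exists>B :: 'x set. finite B \<and> span B = UNIV"
    and "\<exists>B :: 'y set. finite B \<and> span B = UNIV"
    and "linear A"
    and "is_algorithm A \<alpha>1 (\<beta>1 / nl_cond A) F1"
    and "is_algorithm A \<alpha>2 (\<beta>2 / nl_cond A) F2"
  shows "is_algorithm A (\<alpha>1 + \<alpha>2 * \<beta>1) (\<beta>1 * \<beta>2 / nl_cond A) (alg_comp A F2 F1)"
  unfolding is_algorithm_def
proof
  fix b assume b: "b \<in> range A"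
  define m where "m = (\<lambda>b. norm (x_opt A b))"
  define k where "k = nl_cond A"
  define N where "N = onorm A"
  note opt = x_opt_minimizer[OF assms(1,3)]
  have A0: "A 0 = 0" using assms(3) by (rule linear_0)
  have m0: "m 0 = 0" using opt(2)[OF A0] by (simp add: m_def)
  have sol1: "norm (F1 c) \<le> \<alpha>1 * m c" "norm (A (F1 c) - c) \<le> \<beta>1 / k * N * m c"
    if "c \<in> range A" for c
    using assms(4) that by (auto simp: is_algorithm_def is_solution_def m_def k_def N_def)
  have sol2: "norm (F2 c) \<le> \<alpha>2 * m c" "norm (A (F2 c) - c) \<le> \<beta>2 / k * N * m c"
    if "c \<in> range A" for c
    using assms(5) that by (auto simp: is_algorithm_def is_solution_def m_def k_def N_def)
  define x where "x = F1 b"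
  define b' where "b' = b - A x"
  define x' where "x' = F2 b'"
  have b': "b' \<in> range A"
    using b linear_diff[OF assms(3)] unfolding b'_def by (metis imageE rangeI)
  have comp: "alg_comp A F2 F1 b = x + x'"
    by (simp add: alg_comp_def x_def x'_def b'_def Let_def)
  \<comment> \<open>The error of the composed output for \<open>b\<close> is the error of
    \<open>F2\<close> for \<open>b'\<close>.\<close>
  have residual: "A (x + x') - b = A x' - b'"
    using linear_add[OF assms(3)] by (simp add: b'_def)
  have "norm (x + x') \<le> (\<alpha>1 + \<alpha>2 * \<beta>1) * m b \<and>
    norm (A x' - b') \<le> \<beta>1 * \<beta>2 / k * N * m b"
  \<comment> \<open>The case \<open>b = 0\<close> includes \<open>A = 0\<close>, where
    \<open>nl_cond A\<close> is the supremum of the empty set. Since \<open>m 0 = 0\<close>, the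
    norm guarantees force both outputs to be 0.\<close>
  proof (cases "b = 0")
    case True
    then have "x = 0" using sol1(1)[OF b] m0 by (simp add: x_def)
    moreover from this have "b' = 0" using True A0 by (simp add: b'_def)
    moreover from this have "x' = 0" using sol2(1)[OF b'] m0 by (simp add: x'_def)
    ultimately show ?thesis using True m0 A0 by simp
  next
    case False
    \<comment> \<open>For nonzero \<open>b\<close>, the chain
      \<open>0 < norm b \<le> N * m b \<le> k * norm b\<close> makes \<open>m b\<close>,
      \<open>N\<close> and \<open>k\<close> positive, so they can be cancelled.\<close>
    have A_opt: "A (x_opt A b) = b" using opt(1) b by blast
    then have mb: "m b > 0" using False A0 by (auto simp: m_def)
    have "norm b \<le> N * m b"
      using onorm[OF finite_dim_linear_bounded[OF assms(1,3)], of "x_opt A b"] A_opt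
      by (simp add: N_def m_def)
    then have "0 < N * m b" using False by (meson less_le_trans zero_less_norm_iff)
    then have N: "N > 0" using mb by (simp add: zero_less_mult_iff)
    have kappa: "N * m c \<le> k * norm c" if "c \<in> range A" "c \<noteq> 0" for c
      using onorm_x_opt_le_nl_cond[OF assms(1-3) that] by (simp add: N_def m_def k_def)
    have "0 < k * norm b" using kappa[OF b False] \<open>0 < N * m b\<close> by linarith
    then have k: "k > 0" by (simp add: zero_less_mult_iff)
    \<comment> \<open>The signs of the parameters follow from the guarantees on \<open>b\<close>:
      each bounds a norm by the parameter times a positive number.\<close>
    have \<alpha>2: "\<alpha>2 \<ge> 0"
      using order_trans[OF norm_ge_zero sol2(1)[OF b]] mb by (simp add: zero_le_mult_iff)
    have pos: "\<beta> \<ge> 0" if "0 \<le> \<beta> / k * N * m b" for \<beta>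
      using that mb N k by (auto simp: zero_le_mult_iff zero_le_divide_iff)
    have \<beta>1: "\<beta>1 \<ge> 0" by (rule pos[OF order_trans[OF norm_ge_zero sol1(2)[OF b]]])
    have \<beta>2: "\<beta>2 \<ge> 0" by (rule pos[OF order_trans[OF norm_ge_zero sol2(2)[OF b]]])
    have mb': "m b' \<le> \<beta>1 * m b"
    \<comment> \<open>The supremum in \<open>nl_cond\<close> ranges over nonzero right-hand sides,
      so a vanishing residual is treated separately.\<close>
    proof (cases "b' = 0")
      case True
      then show ?thesis using m0 \<beta>1 mb by simp
    next
      case False
      have "norm b' \<le> \<beta>1 / k * N * m b"
        using sol1(2)[OF b] by (simp add: b'_def x_def norm_minus_commute)
      \<comment> \<open>The factor \<open>k\<close> lost in \<open>kappa\<close> cancels the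
        division by \<open>k\<close> in the guarantee of \<open>F1\<close>.\<close>
      then have "k * norm b' \<le> k * (\<beta>1 / k * N * m b)"
        using k by (intro mult_left_mono) auto
      also have "\<dots> = N * (\<beta>1 * m b)" using k by simp
      finally have "N * m b' \<le> N * (\<beta>1 * m b)" using kappa[OF b' False] by linarith
      then show ?thesis using N by simp
    qed
    \<comment> \<open>Both guarantees of \<open>F2\<close> are nonnegative multiples of
      \<open>m b'\<close>, so \<open>m b'\<close> may be replaced by \<open>\<beta>1 * m b\<close>
      in each.\<close>
    have "norm x' \<le> \<alpha>2 * (\<beta>1 * m b)"
      using sol2(1)[OF b'] mult_left_mono[OF mb' \<alpha>2] by (simp add: x'_def)
    then have "norm (x + x') \<le> (\<alpha>1 + \<alpha>2 * \<beta>1) * m b"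
      using norm_triangle_ineq[of x x'] sol1(1)[OF b] by (simp add: x_def algebra_simps)
    moreover have "\<beta>2 / k * N * m b' \<le> \<beta>2 / k * N * (\<beta>1 * m b)"
      using \<beta>2 k N by (intro mult_left_mono[OF mb']) simp
    then have "norm (A x' - b') \<le> \<beta>1 * \<beta>2 / k * N * m b"
      using sol2(2)[OF b'] by (simp add: x'_def mult_ac)
    ultimately show ?thesis by blast
  qed
  then show "is_solution A (\<alpha>1 + \<alpha>2 * \<beta>1) (\<beta>1 * \<beta>2 / nl_cond A) b (alg_comp A F2 F1 b)"
    by (simp add: is_solution_def comp residual m_def k_def N_def)
qed

end
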